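(* Let $w=(w_1,w_2)\in\mathbb{B}_2$. Then $$\mathcal{B}(w)=m_{w_1}\left(\mathcal{B}\left(0,\frac{w_2}{\sqrt{1-|w_1|^2}}\right)\right)=m_{w_1}\left(\overline{\triangle}\left(0,\frac{|w_2|^2}{2-2|w_1|^2-|w_2|^2}\right)\right).$$ In particular, $\mathcal{B}(w)$ is a closed Euclidean disc (which is a single point when $w_2=0$). Moreover, $$\mathcal{B}(w)=\{F_{\tau,\omega}(w):\ \tau,\omega\in\mathbb{C},\ |\tau|=1,\ |\omega|\le 1\}.$$
   Context: $\mathbb{D}$ is the open unit disc in $\mathbb{C}$, $\mathbb{B}_2$ the open Euclidean unit ball in $\mathbb{C}^2$, and $\overline{\triangle}(0,r)=\{\lambda\in\mathbb{C}:|\lambda|\le r\}$ (for $r=0$ this is $\{0\}$). For $a\in\mathbb{D}$, $m_a(\lambda)=\frac{a-\lambda}{1-\overline{a}\lambda}$ is the idempotent (involutive) Möbius map interchanging $0$ and $a$. For $w\in\mathbb{B}_2$, $$\mathcal{B}(w):=\{F(w):\ F:\mathbb{B}_2\to\mathbb{D}\text{ holomorphic},\ F(z_1,0)=z_1\text{ for all }z_1\in\mathbb{D}\}.$$ For $|\tau|=1$ and $|\omega|\le 1$ the holomorphic function $F_{\tau,\omega}:\mathbb{B}_2\to\mathbb{D}$ is $$F_{\tau,\omega}(z_1,z_2):=\frac{2z_1(1-\tau z_1)-\overline{\tau}\omega^2z_2^2}{2(1-\tau z_1)-\omega^2z_2^2}.$$ *)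

theory Defs
  imports "HOL-Analysis.Analysis"
begin

text \<open>
  \<open>\<complex>\<^sup>2\<close> is \<open>complex \<times> complex\<close>; the product norm of the library is the Euclidean one.
\<close>

abbreviation unit_disc :: "complex set" ("\<D>")
  where "\<D> \<equiv> ball 0 1"

abbreviation unit_ball2 :: "(complex \<times> complex) set" ("\<B>\<^sub>2")
  where "\<B>\<^sub>2 \<equiv> ball 0 1"

text \<open>
  Holomorphy in two variables: the real Frechet derivative exists at every point and is
  complex linear. Meant for open \<open>S\<close>.
\<close>

definition holomorphic2_on :: "(complex \<times> complex \<Rightarrow> complex) \<Rightarrow> (complex \<times> complex) set \<Rightarrow> bool"
    (infixl "holomorphic2'_on" 50)
  where "F holomorphic2_on S \<longleftrightarrow>
    (\<forall>z\<in>S. \<exists>a b. (F has_derivative (\<lambda>h. a * fst h + b * snd h)) (at z within S))"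

definition disc_moebius :: "complex \<Rightarrow> complex \<Rightarrow> complex"
  where "disc_moebius a z = (a - z) / (1 - cnj a * z)"

definition interp_values :: "complex \<times> complex \<Rightarrow> complex set"
  where "interp_values w =
    {F w | F. F holomorphic2_on \<B>\<^sub>2 \<and> F ` \<B>\<^sub>2 \<subseteq> \<D> \<and> (\<forall>z\<^sub>1\<in>\<D>. F (z\<^sub>1, 0) = z\<^sub>1)}"

definition F_fam :: "complex \<Rightarrow> complex \<Rightarrow> complex \<times> complex \<Rightarrow> complex"
  where "F_fam \<tau> \<omega> = (\<lambda>(z\<^sub>1, z\<^sub>2).
    (2 * z\<^sub>1 * (1 - \<tau> * z\<^sub>1) - cnj \<tau> * \<omega>\<^sup>2 * z\<^sub>2\<^sup>2) / (2 * (1 - \<tau> * z\<^sub>1) - \<omega>\<^sup>2 * z\<^sub>2\<^sup>2))"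

end

theory Submission
  imports Defs "HOL-Complex_Analysis.Conformal_Mappings"
begin

text \<open>
  An interpolating function \<open>F\<close> fixes every point \<open>p\<close> of the disc \<open>\<D> \<times> {0}\<close>, so in the
  Schwarz--Pick inequality of the ball for \<open>w\<close> and \<open>(p, 0)\<close> the factors \<open>1 - \<bar>p\<bar>\<^sup>2\<close> cancel.
  Letting \<open>p\<close> tend to the unit circle yields a Julia-type inequality at every boundary point:
  \<open>F w\<close> lies in a family of horodiscs, whose intersection is exactly the disc of the theorem.
  Conversely, each value in that disc is attained by some \<open>F_fam \<tau> \<omega>\<close>, since
  \<open>disc_moebius w\<^sub>1 (F_fam \<tau> \<omega> w)\<close> has an explicit form that can be solved for \<open>\<tau>\<close> and \<open>\<omega>\<close>.
\<close>

section \<open>Moebius maps of the disc and the one-variable Schwarz-Pick inequality\<close>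

lemma moebius_denom_nonzero:
  assumes "cmod a < 1" "cmod z \<le> 1"
  shows "1 - cnj a * z \<noteq> 0"
proof
  assume "1 - cnj a * z = 0"
  then have "cmod a * cmod z = 1"
    by (metis complex_mod_cnj eq_iff_diff_eq_0 norm_mult norm_one)
  moreover have "cmod a * cmod z \<le> cmod a * 1"
    using assms(2) by (intro mult_left_mono) auto
  ultimately show False using assms(1) by simp
qed

text \<open>The polarised form of the classical identity for \<open>1 - |m|^2\<close>: taking
  \<open>q = x\<close> gives the norm version below. Distinct \<open>q\<close> and \<open>x\<close>
  are needed to move the Schwarz-Pick inequality into Moebius coordinates in
  \<open>interp_value_bound\<close>.\<close>

lemma one_minus_moebius_moebius:
  assumes "1 - cnj a * x \<noteq> 0" "1 - cnj a * q \<noteq> 0"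
  shows "1 - cnj (disc_moebius a q) * disc_moebius a x =
    (1 - cnj a * a) * (1 - cnj q * x) / ((1 - a * cnj q) * (1 - cnj a * x))"
proof -
  have "1 - a * cnj q \<noteq> 0"
    using assms(2) by (metis complex_cnj_cancel_iff complex_cnj_cnj complex_cnj_diff complex_cnj_mult complex_cnj_one complex_cnj_zero)
  with assms(1) show ?thesis
    unfolding disc_moebius_def by (simp add: divide_simps) (simp add: algebra_simps)
qed

lemma one_minus_norm_moebius:
  assumes "1 - cnj a * x \<noteq> 0"
  shows "1 - (cmod (disc_moebius a x))\<^sup>2 =
    (1 - (cmod a)\<^sup>2) * (1 - (cmod x)\<^sup>2) / (cmod (1 - cnj a * x))\<^sup>2"
proof -
  have "complex_of_real (1 - (cmod (disc_moebius a x))\<^sup>2) =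
      complex_of_real ((1 - (cmod a)\<^sup>2) * (1 - (cmod x)\<^sup>2) / (cmod (1 - cnj a * x))\<^sup>2)"
    using one_minus_moebius_moebius[OF assms assms]
    by (simp add: complex_norm_square mult.commute del: of_real_power)
  then show ?thesis using of_real_eq_iff by blast
qed

lemma moebius_in_disc:
  assumes "cmod a < 1" "cmod x < 1"
  shows "cmod (disc_moebius a x) < 1"
proof -
  have nz: "1 - cnj a * x \<noteq> 0" using assms by (intro moebius_denom_nonzero) auto
  have "0 < (1 - (cmod a)\<^sup>2) * (1 - (cmod x)\<^sup>2) / (cmod (1 - cnj a * x))\<^sup>2"
    using assms nz by (intro divide_pos_pos mult_pos_pos) (auto simp: power_less_one_iff)
  then have "(cmod (disc_moebius a x))\<^sup>2 < 1"
    using one_minus_norm_moebius[OF nz] by linarith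
  then show ?thesis by (simp add: power_less_one_iff)
qed

lemma moebius_involution:
  assumes "cmod a < 1" "1 - cnj a * x \<noteq> 0"
  shows "disc_moebius a (disc_moebius a x) = x"
proof -
  have a: "1 - cnj a * a \<noteq> 0" using moebius_denom_nonzero[of a a] assms by simp
  have *: "1 - cnj a * disc_moebius a x = (1 - cnj a * a) / (1 - cnj a * x)"
    unfolding disc_moebius_def using assms by (simp add: divide_simps) (simp add: algebra_simps)
  have **: "a - disc_moebius a x = (1 - cnj a * a) * x / (1 - cnj a * x)"
    unfolding disc_moebius_def using assms by (simp add: divide_simps) (simp add: algebra_simps)
  show ?thesis
    unfolding disc_moebius_def[of a "disc_moebius a x"] * ** using a assms by simp
qed

lemma moebius_holomorphic:
  assumes "cmod a < 1"
  shows "disc_moebius a holomorphic_on ball 0 1"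
  unfolding disc_moebius_def using moebius_denom_nonzero[OF assms]
  by (intro holomorphic_intros) auto

text \<open>The Schwarz lemma applies to \<open>g\<close>, which is \<open>f\<close> conjugated by
  Moebius maps so that 0 is fixed, at the point \<open>disc_moebius p z\<close>. Denominators are
  cleared so that the factors match those of the inequality in the ball.\<close>

lemma Schwarz_Pick_disc:
  assumes holf: "f holomorphic_on \<D>" and f: "f ` \<D> \<subseteq> \<D>"
    and z: "z \<in> \<D>" and p: "p \<in> \<D>"
  shows "(cmod (1 - cnj (f p) * f z))\<^sup>2 * ((1 - (cmod z)\<^sup>2) * (1 - (cmod p)\<^sup>2)) \<le>
    (cmod (1 - cnj p * z))\<^sup>2 * ((1 - (cmod (f z))\<^sup>2) * (1 - (cmod (f p))\<^sup>2))"
proof -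
  let ?b = "f p" and ?y = "disc_moebius p z"
  define g where "g = disc_moebius ?b \<circ> (f \<circ> disc_moebius p)"
  have lt: "cmod z < 1" "cmod p < 1" "cmod ?b < 1" "cmod (f z) < 1"
    using z p f by (auto simp: image_subset_iff)
  have m: "disc_moebius a ` \<D> \<subseteq> \<D>" if "cmod a < 1" for a
    using moebius_in_disc[OF that] by auto
  have holg: "g holomorphic_on \<D>"
    unfolding g_def
    by (intro holomorphic_on_compose_gen[of _ \<D> _ \<D>] moebius_holomorphic holf lt m)
      (use f m[OF lt(2)] in \<open>auto simp: image_subset_iff\<close>)
  have "cmod (g ?y) \<le> cmod ?y"
  proof (rule Schwarz_Lemma(1)[OF holg])
    show "g 0 = 0" by (simp add: g_def disc_moebius_def)
    show "cmod (g u) < 1" if "cmod u < 1" for u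
      using that f lt by (auto simp: g_def image_subset_iff intro!: moebius_in_disc)
    show "cmod ?y < 1" by (intro moebius_in_disc lt)
  qed
  moreover have nz: "1 - cnj p * z \<noteq> 0" "1 - cnj ?b * f z \<noteq> 0"
    using lt by (simp_all add: moebius_denom_nonzero less_imp_le del: right_minus_eq)
  ultimately have "cmod (disc_moebius ?b (f z)) \<le> cmod ?y"
    using moebius_involution[OF lt(2) nz(1)] by (simp add: g_def)
  then have "1 - (cmod ?y)\<^sup>2 \<le> 1 - (cmod (disc_moebius ?b (f z)))\<^sup>2"
    by (simp add: power_mono)
  then have "(1 - (cmod p)\<^sup>2) * (1 - (cmod z)\<^sup>2) / (cmod (1 - cnj p * z))\<^sup>2 \<le>
      (1 - (cmod ?b)\<^sup>2) * (1 - (cmod (f z))\<^sup>2) / (cmod (1 - cnj ?b * f z))\<^sup>2"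
    unfolding one_minus_norm_moebius[OF nz(1)] one_minus_norm_moebius[OF nz(2)] .
  then show ?thesis
    using nz by (simp add: divide_simps mult_ac)
qed

section \<open>Restriction to complex lines and the Schwarz-Pick inequality of the ball\<close>

lemma holomorphic2_on_line:
  assumes "F holomorphic2_on S" "\<And>l. l \<in> T \<Longrightarrow> (c1 + l * d1, c2 + l * d2) \<in> S"
  shows "(\<lambda>l. F (c1 + l * d1, c2 + l * d2)) holomorphic_on T"
proof (rule holomorphic_onI)
  fix l assume l: "l \<in> T"
  let ?\<phi> = "\<lambda>l. (c1 + l * d1, c2 + l * d2)"
  obtain a b where F: "(F has_derivative (\<lambda>h. a * fst h + b * snd h)) (at (?\<phi> l) within S)"
    using assms l unfolding holomorphic2_on_def by blast
  have \<phi>: "(?\<phi> has_derivative (\<lambda>h. (h * d1, h * d2))) (at l within T)"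
    by (auto intro!: derivative_eq_intros)
  have "((\<lambda>l. F (?\<phi> l)) has_derivative (\<lambda>h. a * fst (h * d1, h * d2) + b * snd (h * d1, h * d2))) (at l within T)"
    by (rule has_derivative_in_compose[OF \<phi>], rule has_derivative_subset[OF F]) (use assms(2) in blast)
  then have "((\<lambda>l. F (?\<phi> l)) has_field_derivative (a * d1 + b * d2)) (at l within T)"
    unfolding has_field_derivative_def by (rule has_derivative_eq_rhs) (simp add: fun_eq_iff algebra_simps)
  then show "(\<lambda>l. F (?\<phi> l)) field_differentiable at l within T"
    unfolding field_differentiable_def by blast
qed

lemma mem_unit_ball2_iff: "(z\<^sub>1, z\<^sub>2) \<in> \<B>\<^sub>2 \<longleftrightarrow> (cmod z\<^sub>1)\<^sup>2 + (cmod z\<^sub>2)\<^sup>2 < 1"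
  by (simp add: dist_norm norm_Pair)

lemma unit_ball2_fst:
  assumes "(z\<^sub>1, z\<^sub>2) \<in> \<B>\<^sub>2"
  shows "cmod z\<^sub>1 < 1"
proof -
  have "(cmod z\<^sub>1)\<^sup>2 < 1"
    using assms[unfolded mem_unit_ball2_iff] zero_le_power2[of "cmod z\<^sub>2"] by linarith
  then show ?thesis by (simp add: power_less_one_iff)
qed

lemma Schwarz_Pick_ball2:
  assumes hol: "F holomorphic2_on \<B>\<^sub>2" and F: "F ` \<B>\<^sub>2 \<subseteq> \<D>"
    and z: "(z\<^sub>1, z\<^sub>2) \<in> \<B>\<^sub>2" and p: "(p\<^sub>1, p\<^sub>2) \<in> \<B>\<^sub>2"
  shows "(cmod (1 - cnj (F (p\<^sub>1, p\<^sub>2)) * F (z\<^sub>1, z\<^sub>2)))\<^sup>2 *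
      ((1 - (cmod z\<^sub>1)\<^sup>2 - (cmod z\<^sub>2)\<^sup>2) * (1 - (cmod p\<^sub>1)\<^sup>2 - (cmod p\<^sub>2)\<^sup>2)) \<le>
    (cmod (1 - z\<^sub>1 * cnj p\<^sub>1 - z\<^sub>2 * cnj p\<^sub>2))\<^sup>2 *
      ((1 - (cmod (F (z\<^sub>1, z\<^sub>2)))\<^sup>2) * (1 - (cmod (F (p\<^sub>1, p\<^sub>2)))\<^sup>2))"
proof (cases "(z\<^sub>1, z\<^sub>2) = (p\<^sub>1, p\<^sub>2)")
  case True
  \<comment> \<open>Coinciding points determine no line; here both sides of the inequality are
    equal.\<close>
  have sq: "(cmod (1 - cnj a * a))\<^sup>2 = (1 - (cmod a)\<^sup>2) * (1 - (cmod a)\<^sup>2)" for a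
  proof -
    have "1 - cnj a * a = complex_of_real (1 - (cmod a)\<^sup>2)"
      by (simp add: complex_norm_square mult.commute del: of_real_power)
    then show ?thesis
      by (metis norm_of_real power2_abs power2_eq_square)
  qed
  have "1 - z\<^sub>1 * cnj z\<^sub>1 - z\<^sub>2 * cnj z\<^sub>2 = complex_of_real (1 - (cmod z\<^sub>1)\<^sup>2 - (cmod z\<^sub>2)\<^sup>2)"
    by (simp add: complex_norm_square del: of_real_power)
  then have "(cmod (1 - z\<^sub>1 * cnj z\<^sub>1 - z\<^sub>2 * cnj z\<^sub>2))\<^sup>2 =
      (1 - (cmod z\<^sub>1)\<^sup>2 - (cmod z\<^sub>2)\<^sup>2) * (1 - (cmod z\<^sub>1)\<^sup>2 - (cmod z\<^sub>2)\<^sup>2)"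
    by (metis norm_of_real power2_abs power2_eq_square)
  with True show ?thesis by (simp add: sq)
next
  case False
  \<comment> \<open>The complex line through the two points is \<open>{c + l d}\<close> with \<open>d\<close> a unit vector and \<open>c\<close>
    orthogonal to \<open>d\<close>; it meets the ball in a disc of radius \<open>R\<close>, on which the one-variable
    inequality applies.\<close>
  define N where "N = complex_of_real (norm (z\<^sub>1 - p\<^sub>1, z\<^sub>2 - p\<^sub>2))"
  define d\<^sub>1 d\<^sub>2 where "d\<^sub>1 = (z\<^sub>1 - p\<^sub>1) / N" and "d\<^sub>2 = (z\<^sub>2 - p\<^sub>2) / N"
  define \<alpha> \<beta> where "\<alpha> = z\<^sub>1 * cnj d\<^sub>1 + z\<^sub>2 * cnj d\<^sub>2" and "\<beta> = p\<^sub>1 * cnj d\<^sub>1 + p\<^sub>2 * cnj d\<^sub>2"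
  define c\<^sub>1 c\<^sub>2 where "c\<^sub>1 = z\<^sub>1 - \<alpha> * d\<^sub>1" and "c\<^sub>2 = z\<^sub>2 - \<alpha> * d\<^sub>2"
  define K where "K = (cmod c\<^sub>1)\<^sup>2 + (cmod c\<^sub>2)\<^sup>2"
  define R where "R = sqrt (1 - K)"
  have N0: "N \<noteq> 0" using False by (auto simp: N_def norm_prod_def sum_power2_eq_zero_iff)
  have Nsq: "N * N = (z\<^sub>1 - p\<^sub>1) * cnj (z\<^sub>1 - p\<^sub>1) + (z\<^sub>2 - p\<^sub>2) * cnj (z\<^sub>2 - p\<^sub>2)"
  proof -
    have "N * N = complex_of_real ((cmod (z\<^sub>1 - p\<^sub>1))\<^sup>2 + (cmod (z\<^sub>2 - p\<^sub>2))\<^sup>2)"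
      by (simp add: N_def norm_Pair flip: of_real_mult)
    then show ?thesis by (simp add: complex_norm_square del: of_real_power)
  qed
  have cnjN: "cnj N = N" by (simp add: N_def)
  have z_p: "z\<^sub>1 - p\<^sub>1 = N * d\<^sub>1" "z\<^sub>2 - p\<^sub>2 = N * d\<^sub>2" using N0 by (simp_all add: d\<^sub>1_def d\<^sub>2_def)
  have unit: "d\<^sub>1 * cnj d\<^sub>1 + d\<^sub>2 * cnj d\<^sub>2 = 1"
  proof -
    have "d\<^sub>1 * cnj d\<^sub>1 + d\<^sub>2 * cnj d\<^sub>2 = N * N / (N * N)"
      unfolding d\<^sub>1_def d\<^sub>2_def complex_cnj_divide cnjN times_divide_times_eq add_divide_distrib[symmetric] Nsq ..
    then show ?thesis using N0 by simp
  qed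
  have "\<alpha> - \<beta> = N * (d\<^sub>1 * cnj d\<^sub>1 + d\<^sub>2 * cnj d\<^sub>2)"
    using z_p unfolding \<alpha>_def \<beta>_def by algebra
  then have ab: "\<alpha> = \<beta> + N" using unit by (simp add: algebra_simps)
  have zc: "z\<^sub>1 = c\<^sub>1 + \<alpha> * d\<^sub>1" "z\<^sub>2 = c\<^sub>2 + \<alpha> * d\<^sub>2" by (simp_all add: c\<^sub>1_def c\<^sub>2_def)
  have pc: "p\<^sub>1 = c\<^sub>1 + \<beta> * d\<^sub>1" "p\<^sub>2 = c\<^sub>2 + \<beta> * d\<^sub>2"
    using z_p zc ab by (simp_all add: algebra_simps)
  have "c\<^sub>1 * cnj d\<^sub>1 + c\<^sub>2 * cnj d\<^sub>2 = \<alpha> - \<alpha> * (d\<^sub>1 * cnj d\<^sub>1 + d\<^sub>2 * cnj d\<^sub>2)"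
    unfolding c\<^sub>1_def c\<^sub>2_def \<alpha>_def by (simp add: algebra_simps)
  then have orth: "c\<^sub>1 * cnj d\<^sub>1 + c\<^sub>2 * cnj d\<^sub>2 = 0" using unit by simp
  then have orth': "cnj c\<^sub>1 * d\<^sub>1 + cnj c\<^sub>2 * d\<^sub>2 = 0"
    by (metis complex_cnj_add complex_cnj_cnj complex_cnj_mult complex_cnj_zero)
  \<comment> \<open>Hermitian product of two points of the line. Orthogonality of c and d kills the
    cross terms; equal parameters give the norms, and \<alpha> with \<beta> gives the mixed
    factor.\<close>
  have herm: "(c\<^sub>1 + l * d\<^sub>1) * cnj (c\<^sub>1 + m * d\<^sub>1) + (c\<^sub>2 + l * d\<^sub>2) * cnj (c\<^sub>2 + m * d\<^sub>2) = K + l * cnj m" for l m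
  proof -
    have "(c\<^sub>1 + l * d\<^sub>1) * cnj (c\<^sub>1 + m * d\<^sub>1) + (c\<^sub>2 + l * d\<^sub>2) * cnj (c\<^sub>2 + m * d\<^sub>2)
      = (c\<^sub>1 * cnj c\<^sub>1 + c\<^sub>2 * cnj c\<^sub>2) + cnj m * (c\<^sub>1 * cnj d\<^sub>1 + c\<^sub>2 * cnj d\<^sub>2)
        + l * (cnj c\<^sub>1 * d\<^sub>1 + cnj c\<^sub>2 * d\<^sub>2) + l * cnj m * (d\<^sub>1 * cnj d\<^sub>1 + d\<^sub>2 * cnj d\<^sub>2)"
      by (simp add: algebra_simps)
    also have "\<dots> = K + l * cnj m"
      unfolding orth orth' unit K_def by (simp add: complex_norm_square del: of_real_power)
    finally show ?thesis .
  qed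
  have norm_line: "(cmod (c\<^sub>1 + l * d\<^sub>1))\<^sup>2 + (cmod (c\<^sub>2 + l * d\<^sub>2))\<^sup>2 = K + (cmod l)\<^sup>2" for l
  proof -
    have "complex_of_real ((cmod (c\<^sub>1 + l * d\<^sub>1))\<^sup>2 + (cmod (c\<^sub>2 + l * d\<^sub>2))\<^sup>2) = complex_of_real (K + (cmod l)\<^sup>2)"
      unfolding of_real_add complex_norm_square herm ..
    then show ?thesis using of_real_eq_iff by blast
  qed
  have nz: "(cmod z\<^sub>1)\<^sup>2 + (cmod z\<^sub>2)\<^sup>2 = K + (cmod \<alpha>)\<^sup>2" using norm_line[of \<alpha>] zc by simp
  have np: "(cmod p\<^sub>1)\<^sup>2 + (cmod p\<^sub>2)\<^sup>2 = K + (cmod \<beta>)\<^sup>2" using norm_line[of \<beta>] pc by simp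
  have zp: "z\<^sub>1 * cnj p\<^sub>1 + z\<^sub>2 * cnj p\<^sub>2 = K + \<alpha> * cnj \<beta>" using herm[of \<alpha> \<beta>] zc pc by simp
  have lt: "K + (cmod \<alpha>)\<^sup>2 < 1" "K + (cmod \<beta>)\<^sup>2 < 1"
    using z[unfolded mem_unit_ball2_iff] p[unfolded mem_unit_ball2_iff] nz np by simp_all
  then have R: "R > 0" "R\<^sup>2 = 1 - K"
    by (auto simp: R_def) (smt (verit) zero_le_power2)+
  define g where "g = (\<lambda>l. F (c\<^sub>1 + l * (R * d\<^sub>1), c\<^sub>2 + l * (R * d\<^sub>2)))"
  have in_ball: "(c\<^sub>1 + l * (R * d\<^sub>1), c\<^sub>2 + l * (R * d\<^sub>2)) \<in> \<B>\<^sub>2" if "l \<in> \<D>" for l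
  proof -
    have "(cmod (l * R))\<^sup>2 < R\<^sup>2 * 1"
      using that R(1) by (simp add: norm_mult power_mult_distrib power_less_one_iff)
    then show ?thesis
      unfolding mem_unit_ball2_iff using norm_line[of "l * R"] R(2) by (simp add: mult.assoc)
  qed
  have "g holomorphic_on \<D>"
    unfolding g_def by (rule holomorphic2_on_line[OF hol in_ball])
  moreover have "g ` \<D> \<subseteq> \<D>"
    using F in_ball unfolding g_def by blast
  moreover have inD: "\<alpha> / R \<in> \<D>" "\<beta> / R \<in> \<D>"
  proof -
    have "cmod \<alpha> < R" "cmod \<beta> < R"
      by (rule power2_less_imp_less; use lt R in simp)+
    then show "\<alpha> / R \<in> \<D>" "\<beta> / R \<in> \<D>"
      using R(1) by (simp_all add: norm_divide)
  qed
  ultimately have "(cmod (1 - cnj (g (\<beta> / R)) * g (\<alpha> / R)))\<^sup>2 * ((1 - (cmod (\<alpha> / R))\<^sup>2) * (1 - (cmod (\<beta> / R))\<^sup>2)) \<le>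
      (cmod (1 - cnj (\<beta> / R) * (\<alpha> / R)))\<^sup>2 * ((1 - (cmod (g (\<alpha> / R)))\<^sup>2) * (1 - (cmod (g (\<beta> / R)))\<^sup>2))"
    by (rule Schwarz_Pick_disc)
  moreover have "g (\<alpha> / R) = F (z\<^sub>1, z\<^sub>2)" "g (\<beta> / R) = F (p\<^sub>1, p\<^sub>2)"
    using R(1) zc pc by (simp_all add: g_def)
  \<comment> \<open>Since \<open>R^2 = 1 - K\<close>, rescaling the slice to the unit disc divides
    each factor \<open>1 - |z|^2\<close> and \<open>1 - |p|^2\<close> by \<open>R^2\<close> and the
    squared mixed factor by \<open>R^4\<close>. Both sides thus carry the same power of R, which
    cancels.\<close>
  moreover have "1 - (cmod (\<alpha> / R))\<^sup>2 = (1 - (cmod z\<^sub>1)\<^sup>2 - (cmod z\<^sub>2)\<^sup>2) / R\<^sup>2"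
    "1 - (cmod (\<beta> / R))\<^sup>2 = (1 - (cmod p\<^sub>1)\<^sup>2 - (cmod p\<^sub>2)\<^sup>2) / R\<^sup>2"
    using R nz np by (simp_all add: norm_divide power_divide field_simps)
  moreover have "(cmod (1 - cnj (\<beta> / R) * (\<alpha> / R)))\<^sup>2 = (cmod (1 - z\<^sub>1 * cnj p\<^sub>1 - z\<^sub>2 * cnj p\<^sub>2))\<^sup>2 / (R\<^sup>2 * R\<^sup>2)"
  proof -
    have "(1 - z\<^sub>1 * cnj p\<^sub>1 - z\<^sub>2 * cnj p\<^sub>2) = complex_of_real (R\<^sup>2) - cnj \<beta> * \<alpha>"
      unfolding R(2) using zp by (simp add: algebra_simps)
    then have "1 - cnj (\<beta> / R) * (\<alpha> / R) = (1 - z\<^sub>1 * cnj p\<^sub>1 - z\<^sub>2 * cnj p\<^sub>2) / complex_of_real (R\<^sup>2)"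
      using R(1) by (simp add: divide_simps power2_eq_square)
    then show ?thesis
      by (simp add: norm_divide norm_power power_divide power2_eq_square[of "R\<^sup>2"])
  qed
  ultimately show ?thesis
    using R(1) by (simp add: divide_le_cancel)
qed

section \<open>Every interpolation value lies in the asserted disc\<close>

text \<open>The Moebius map at \<open>w\<^sub>1\<close> sends \<open>w\<^sub>1\<close> to 0, the
  value of F to x and the test point p to q. In these coordinates the constraint is invariant under
  rotating x and q together, so the best choice of q yields a bound on |x| alone.\<close>

lemma interp_value_bound:
  assumes hol: "F holomorphic2_on \<B>\<^sub>2" and F: "F ` \<B>\<^sub>2 \<subseteq> \<D>"
    and id: "\<And>z\<^sub>1. z\<^sub>1 \<in> \<D> \<Longrightarrow> F (z\<^sub>1, 0) = z\<^sub>1"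
    and w: "(w\<^sub>1, w\<^sub>2) \<in> \<B>\<^sub>2"
  shows "cmod (disc_moebius w\<^sub>1 (F (w\<^sub>1, w\<^sub>2))) \<le> (cmod w\<^sub>2)\<^sup>2 / (2 - 2 * (cmod w\<^sub>1)\<^sup>2 - (cmod w\<^sub>2)\<^sup>2)"
proof -
  define A s where "A = 1 - (cmod w\<^sub>1)\<^sup>2" and "s = (cmod w\<^sub>2)\<^sup>2"
  define x where "x = disc_moebius w\<^sub>1 (F (w\<^sub>1, w\<^sub>2))"
  define r where "r = cmod x"
  have s: "0 \<le> s" "s < A" using w[unfolded mem_unit_ball2_iff] by (auto simp: A_def s_def)
  have w1: "cmod w\<^sub>1 < 1" using w by (rule unit_ball2_fst)
  have Fw: "cmod (F (w\<^sub>1, w\<^sub>2)) < 1" using F w by (auto simp: image_subset_iff)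
  have x1: "cmod x < 1" unfolding x_def by (intro moebius_in_disc w1 Fw)
  have Fx: "F (w\<^sub>1, w\<^sub>2) = disc_moebius w\<^sub>1 x"
    using moebius_involution[OF w1 moebius_denom_nonzero] w1 Fw by (simp add: x_def less_imp_le)
  have key: "(cmod (1 - cnj q * x))\<^sup>2 * (A - s) \<le> A * (1 - (cmod x)\<^sup>2)" if q: "cmod q < 1" for q
  proof -
    define p where "p = disc_moebius w\<^sub>1 q"
    have p: "cmod p < 1" unfolding p_def by (intro moebius_in_disc w1 q)
    have "(cmod (1 - cnj p * F (w\<^sub>1, w\<^sub>2)))\<^sup>2 * ((A - s) * (1 - (cmod p)\<^sup>2)) \<le>
        (cmod (1 - w\<^sub>1 * cnj p))\<^sup>2 * ((1 - (cmod (F (w\<^sub>1, w\<^sub>2)))\<^sup>2) * (1 - (cmod p)\<^sup>2))"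
      using Schwarz_Pick_ball2[OF hol F w, of p 0] id[of p] p
      by (simp add: A_def s_def)
    moreover have "0 < 1 - (cmod p)\<^sup>2" using p by (simp add: power_less_one_iff)
    ultimately have *: "(cmod (1 - cnj p * F (w\<^sub>1, w\<^sub>2)))\<^sup>2 * (A - s) \<le>
        (cmod (1 - cnj p * w\<^sub>1))\<^sup>2 * (1 - (cmod (F (w\<^sub>1, w\<^sub>2)))\<^sup>2)"
      using mult_le_cancel_right_pos by (simp add: mult.assoc[symmetric] mult.commute[of _ "cnj p"])
    have nz: "1 - cnj w\<^sub>1 * x \<noteq> 0" "1 - cnj w\<^sub>1 * q \<noteq> 0" "1 - cnj w\<^sub>1 * 0 \<noteq> 0" "1 - cnj q * w\<^sub>1 \<noteq> 0"
      using w1 x1 q by (simp_all add: moebius_denom_nonzero less_imp_le del: right_minus_eq)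
    have A: "(cmod (1 - cnj w\<^sub>1 * w\<^sub>1)) = A"
    proof -
      have "1 - cnj w\<^sub>1 * w\<^sub>1 = complex_of_real A"
        by (simp add: A_def complex_norm_square mult.commute del: of_real_power)
      then show ?thesis using s by (metis abs_of_pos le_less_trans norm_of_real)
    qed
    define Q X where "Q = (cmod (1 - cnj q * w\<^sub>1))\<^sup>2" and "X = (cmod (1 - cnj w\<^sub>1 * x))\<^sup>2"
    have QX: "Q > 0" "X > 0" using nz by (simp_all add: Q_def X_def)
    have e1: "(cmod (1 - cnj p * F (w\<^sub>1, w\<^sub>2)))\<^sup>2 = A\<^sup>2 * (cmod (1 - cnj q * x))\<^sup>2 / (Q * X)"
      unfolding Fx p_def one_minus_moebius_moebius[OF nz(1,2)]
      by (simp add: norm_mult norm_divide power_mult_distrib power_divide A Q_def X_def mult.commute[of w\<^sub>1])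
    \<comment> \<open>\<open>w\<^sub>1\<close> is the Moebius image of 0, so this is the same
      identity as for \<open>e1\<close>, at the point 0.\<close>
    have e2: "(cmod (1 - cnj p * w\<^sub>1))\<^sup>2 = A\<^sup>2 / Q"
      using one_minus_moebius_moebius[OF nz(3,2)]
      by (simp add: disc_moebius_def[of _ 0] norm_divide power_divide A Q_def p_def mult.commute[of w\<^sub>1])
    have e3: "1 - (cmod (F (w\<^sub>1, w\<^sub>2)))\<^sup>2 = A * (1 - (cmod x)\<^sup>2) / X"
      unfolding Fx one_minus_norm_moebius[OF nz(1)] by (simp add: A_def X_def)
    \<comment> \<open>The substitutions give both sides the common factor
      \<open>A^2 / (Q * X)\<close>; all dependence on \<open>w\<^sub>1\<close> beyond A disappears
      with it.\<close>
    have "A\<^sup>2 / (Q * X) * ((cmod (1 - cnj q * x))\<^sup>2 * (A - s)) \<le> A\<^sup>2 / (Q * X) * (A * (1 - (cmod x)\<^sup>2))"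
      using *[unfolded e1 e2 e3] by (simp add: mult_ac)
    moreover have "A\<^sup>2 / (Q * X) > 0" using QX s by simp
    ultimately show ?thesis using mult_le_cancel_left_pos by blast
  qed
  have "(1 + t * r)\<^sup>2 * (A - s) \<le> A * (1 - r\<^sup>2)" if t: "0 < t" "t < 1" for t :: real
  proof -
    \<comment> \<open>the direction of the most restrictive horodisc\<close>
    define q where "q = - t * sgn x"
    have "cmod q < 1" using t by (simp add: q_def norm_mult norm_sgn)
    moreover have "1 - cnj q * x = complex_of_real (1 + t * r)"
    proof (cases "x = 0")
      case False
      then have "cnj (sgn x) * x = complex_of_real (cmod x)"
        using complex_norm_square[of x] by (simp add: sgn_eq field_simps power2_eq_square)
      then show ?thesis by (simp add: q_def r_def mult.assoc)
    qed (simp add: r_def)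
    ultimately show ?thesis
      using key[of q] by (simp add: r_def del: of_real_add of_real_mult)
  qed
  \<comment> \<open>Only \<open>t < 1\<close> is available, since q has to stay in the open disc.
    The limit from the left reaches the boundary point.\<close>
  then have ev: "\<forall>\<^sub>F t in at_left 1. (1 + t * r)\<^sup>2 * (A - s) \<le> A * (1 - r\<^sup>2)"
    by (subst eventually_at_left[of 0]) (auto intro!: exI[of _ 0])
  have lim: "((\<lambda>t. (1 + t * r)\<^sup>2 * (A - s)) \<longlongrightarrow> (1 + 1 * r)\<^sup>2 * (A - s)) (at_left 1)"
    by (intro tendsto_intros)
  have "(1 + r)\<^sup>2 * (A - s) \<le> A * (1 - r\<^sup>2)"
    using tendsto_upperbound[OF lim ev] by simp
  \<comment> \<open>Because \<open>1 - r^2 = (1 - r) * (1 + r)\<close>, one factor cancels and the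
    quadratic condition on r becomes linear.\<close>
  then have "(1 + r) * ((1 + r) * (A - s)) \<le> (1 + r) * (A * (1 - r))"
    by (simp add: power2_eq_square algebra_simps)
  moreover have "1 + r > 0" by (simp add: r_def add_pos_nonneg)
  ultimately have "(1 + r) * (A - s) \<le> A * (1 - r)"
    using mult_le_cancel_left_pos by blast
  then have "r * (2 * A - s) \<le> s" by (simp add: algebra_simps)
  then have "r \<le> s / (2 * A - s)" using s by (simp add: pos_le_divide_eq)
  then show ?thesis by (simp add: r_def x_def A_def s_def algebra_simps)
qed

section \<open>The family \<open>F_fam\<close> and the values it attains\<close>

text \<open>Write F for the value of \<open>F_fam\<close>. Then \<open>z\<^sub>1 - F\<close> and
  \<open>1 - cnj z\<^sub>1 * F\<close> have the common denominator \<open>2 * \<kappa> - u\<close>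
  and the numerators \<open>cnj \<tau> * u * \<kappa>\<close> and E. With
  \<open>A = 1 - |z\<^sub>1|^2\<close>, everything is controlled by
  \<open>|u| < A <= 2 * |\<kappa>|\<close>: this keeps the denominator away from 0 and gives
  \<open>|E| >= |\<kappa>| * (2 * A - |u|) > |\<kappa>| * |u|\<close>.\<close>

lemma F_fam_moebius:
  assumes z: "(z\<^sub>1, z\<^sub>2) \<in> \<B>\<^sub>2" and \<tau>: "cmod \<tau> = 1" and \<omega>: "cmod \<omega> \<le> 1"
  defines "\<kappa> \<equiv> 1 - \<tau> * z\<^sub>1" and "u \<equiv> \<omega>\<^sup>2 * z\<^sub>2\<^sup>2"
  defines "E \<equiv> 2 * \<kappa> * complex_of_real (1 - (cmod z\<^sub>1)\<^sup>2) - u * cnj \<kappa>"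
  shows "2 * \<kappa> - u \<noteq> 0" and "E \<noteq> 0" and "\<kappa> \<noteq> 0"
    and "F_fam \<tau> \<omega> (z\<^sub>1, z\<^sub>2) = disc_moebius z\<^sub>1 (cnj \<tau> * u * \<kappa> / E)"
    and "cmod (cnj \<tau> * u * \<kappa> / E) < 1"
proof -
  define A where "A = 1 - (cmod z\<^sub>1)\<^sup>2"
  define F where "F = F_fam \<tau> \<omega> (z\<^sub>1, z\<^sub>2)"
  have z1: "cmod z\<^sub>1 < 1"
    using z by (rule unit_ball2_fst)
  have "(cmod \<omega>)\<^sup>2 * (cmod z\<^sub>2)\<^sup>2 \<le> 1 * (cmod z\<^sub>2)\<^sup>2"
    using \<omega> by (intro mult_right_mono) (auto simp: power_le_one)
  then have u: "cmod u < A"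
    using z[unfolded mem_unit_ball2_iff] by (simp add: u_def norm_mult norm_power A_def)
  have "cmod \<kappa> \<ge> 1 - cmod (\<tau> * z\<^sub>1)"
    unfolding \<kappa>_def by (metis norm_one norm_triangle_ineq2)
  then have \<kappa>: "cmod \<kappa> \<ge> 1 - cmod z\<^sub>1" using \<tau> by (simp add: norm_mult)
  then show \<kappa>0: "\<kappa> \<noteq> 0" using z1 by auto
  have "A = (1 - cmod z\<^sub>1) * (1 + cmod z\<^sub>1)" by (simp add: A_def power2_eq_square algebra_simps)
  also have "\<dots> \<le> (1 - cmod z\<^sub>1) * 2" using z1 by (intro mult_left_mono) auto
  finally have "cmod u < cmod (2 * \<kappa>)" using u \<kappa> by (simp add: norm_mult)
  then show D: "2 * \<kappa> - u \<noteq> 0" by auto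
  have "cmod E \<ge> cmod (2 * \<kappa> * complex_of_real A) - cmod (u * cnj \<kappa>)"
    unfolding E_def A_def by (rule norm_triangle_ineq2)
  then have E: "cmod E \<ge> cmod \<kappa> * (2 * A - cmod u)"
    using u by (simp add: norm_mult algebra_simps) (smt (verit) norm_ge_zero)
  have "cmod \<kappa> * cmod u < cmod \<kappa> * (2 * A - cmod u)"
    using u \<kappa>0 by (intro mult_strict_left_mono) auto
  then have E': "cmod u * cmod \<kappa> < cmod E" using E by (simp add: mult.commute)
  then show E0: "E \<noteq> 0" by (smt (verit) norm_ge_zero mult_nonneg_nonneg norm_zero)
  show "cmod (cnj \<tau> * u * \<kappa> / E) < 1"
    using E' E0 \<tau> by (simp add: norm_mult norm_divide)
  have \<tau>\<tau>: "\<tau> * cnj \<tau> = 1" using \<tau> by (simp add: complex_norm_square[symmetric])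
  have FD: "F * (2 * \<kappa> - u) = 2 * z\<^sub>1 * \<kappa> - cnj \<tau> * u"
    using D by (simp add: F_def F_fam_def \<kappa>_def u_def mult.assoc)
  have A: "complex_of_real A = 1 - z\<^sub>1 * cnj z\<^sub>1"
    by (simp add: A_def complex_norm_square del: of_real_power)
  have "(1 - cnj z\<^sub>1 * F) * (2 * \<kappa> - u) = (2 * \<kappa> - u) - cnj z\<^sub>1 * (F * (2 * \<kappa> - u))"
    by (simp add: algebra_simps)
  also have "\<dots> = E"
    unfolding FD E_def A_def[symmetric] A by (simp add: \<kappa>_def algebra_simps)
  finally have e1: "(1 - cnj z\<^sub>1 * F) * (2 * \<kappa> - u) = E" .
  have "(z\<^sub>1 - F) * (2 * \<kappa> - u) = z\<^sub>1 * (2 * \<kappa> - u) - F * (2 * \<kappa> - u)"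
    by (simp add: algebra_simps)
  \<comment> \<open>The second summand is split off because it vanishes for \<tau> on the unit
    circle.\<close>
  also have "\<dots> = cnj \<tau> * u * \<kappa> + z\<^sub>1 * u * (\<tau> * cnj \<tau> - 1)"
    unfolding FD by (simp add: \<kappa>_def algebra_simps)
  finally have e2: "(z\<^sub>1 - F) * (2 * \<kappa> - u) = cnj \<tau> * u * \<kappa>" using \<tau>\<tau> by simp
  have nz: "1 - cnj z\<^sub>1 * F \<noteq> 0" using e1 E0 by auto
  have "disc_moebius z\<^sub>1 F = cnj \<tau> * u * \<kappa> / E"
    unfolding e1[symmetric] e2[symmetric] disc_moebius_def using D by simp
  then show "F_fam \<tau> \<omega> (z\<^sub>1, z\<^sub>2) = disc_moebius z\<^sub>1 (cnj \<tau> * u * \<kappa> / E)"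
    using moebius_involution[OF z1 nz] F_def by simp
qed

lemma holomorphic2_on_divide:
  assumes "f holomorphic2_on S" "g holomorphic2_on S" "\<And>z. z \<in> S \<Longrightarrow> g z \<noteq> 0"
  shows "(\<lambda>z. f z / g z) holomorphic2_on S"
  unfolding holomorphic2_on_def
proof
  fix z assume z: "z \<in> S"
  obtain a b c d where f: "(f has_derivative (\<lambda>h. a * fst h + b * snd h)) (at z within S)"
    and g: "(g has_derivative (\<lambda>h. c * fst h + d * snd h)) (at z within S)"
    using assms(1,2) z unfolding holomorphic2_on_def by blast
  have "((\<lambda>z. f z / g z) has_derivative
      (\<lambda>h. (a / g z - f z * c / (g z)\<^sup>2) * fst h + (b / g z - f z * d / (g z)\<^sup>2) * snd h)) (at z within S)"
    by (rule has_derivative_eq_rhs[OF has_derivative_divide[OF f g assms(3)[OF z]]])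
      (use assms(3)[OF z] in \<open>simp add: fun_eq_iff field_simps power2_eq_square\<close>)
  then show "\<exists>a b. ((\<lambda>z. f z / g z) has_derivative (\<lambda>h. a * fst h + b * snd h)) (at z within S)"
    by blast
qed

lemma F_fam_in_interp_values:
  assumes w: "w \<in> \<B>\<^sub>2" and \<tau>: "cmod \<tau> = 1" and \<omega>: "cmod \<omega> \<le> 1"
  shows "F_fam \<tau> \<omega> w \<in> interp_values w"
proof -
  note fam = F_fam_moebius[OF _ \<tau> \<omega>]
  define f g where "f = (\<lambda>z. 2 * fst z * (1 - \<tau> * fst z) - cnj \<tau> * \<omega>\<^sup>2 * (snd z)\<^sup>2)"
    and "g = (\<lambda>z. 2 * (1 - \<tau> * fst z) - \<omega>\<^sup>2 * (snd z)\<^sup>2)"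
  have "(f has_derivative (\<lambda>h. (2 - 4 * \<tau> * fst z) * fst h + (- 2 * cnj \<tau> * \<omega>\<^sup>2 * snd z) * snd h)) (at z within \<B>\<^sub>2)" for z
    unfolding f_def by (auto intro!: derivative_eq_intros simp: fun_eq_iff algebra_simps)
  moreover have "(g has_derivative (\<lambda>h. (- 2 * \<tau>) * fst h + (- 2 * \<omega>\<^sup>2 * snd z) * snd h)) (at z within \<B>\<^sub>2)" for z
    unfolding g_def by (auto intro!: derivative_eq_intros simp: fun_eq_iff algebra_simps)
  ultimately have "f holomorphic2_on \<B>\<^sub>2" "g holomorphic2_on \<B>\<^sub>2"
    unfolding holomorphic2_on_def by blast+
  moreover have "g z \<noteq> 0" if "z \<in> \<B>\<^sub>2" for z
    using fam(1)[of "fst z" "snd z"] that by (simp add: g_def)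
  ultimately have "(\<lambda>z. f z / g z) holomorphic2_on \<B>\<^sub>2"
    by (rule holomorphic2_on_divide)
  moreover have "(\<lambda>z. f z / g z) = F_fam \<tau> \<omega>"
    by (simp add: fun_eq_iff f_def g_def F_fam_def)
  ultimately have "F_fam \<tau> \<omega> holomorphic2_on \<B>\<^sub>2" by simp
  moreover have "F_fam \<tau> \<omega> ` \<B>\<^sub>2 \<subseteq> \<D>"
  proof (clarify)
    fix a b :: complex assume z: "(a, b) \<in> \<B>\<^sub>2"
    then have "cmod a < 1"
      by (rule unit_ball2_fst)
    then show "F_fam \<tau> \<omega> (a, b) \<in> \<D>"
      using moebius_in_disc fam(4,5)[OF z] by simp
  qed
  moreover have "F_fam \<tau> \<omega> (a, 0) = a" if "a \<in> \<D>" for a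
    using fam(1)[of a 0] that by (simp add: F_fam_def divide_simps algebra_simps)
  ultimately show ?thesis unfolding interp_values_def by blast
qed

text \<open>By \<open>F_fam_moebius\<close>, the equation to solve is
  \<open>cnj \<tau> * u * \<kappa> / E = x\<close>. The ansatz
  \<open>u = y * \<kappa> / cnj \<kappa>\<close> with real \<open>y >= 0\<close> gives
  \<open>E = \<kappa> * (2 * A - y)\<close>, so the left side becomes the unimodular number
  \<open>cnj \<tau> * \<kappa> / cnj \<kappa>\<close> times \<open>y / (2 * A - y)\<close>. Now
  \<tau> is chosen for the argument of x and y for its modulus.\<close>

lemma moebius_disc_value_is_F_fam_value:
  assumes w: "(w\<^sub>1, w\<^sub>2) \<in> \<B>\<^sub>2"
    and x: "cmod x \<le> (cmod w\<^sub>2)\<^sup>2 / (2 - 2 * (cmod w\<^sub>1)\<^sup>2 - (cmod w\<^sub>2)\<^sup>2)"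
  obtains \<tau> \<omega> where "cmod \<tau> = 1" "cmod \<omega> \<le> 1" "F_fam \<tau> \<omega> (w\<^sub>1, w\<^sub>2) = disc_moebius w\<^sub>1 x"
proof -
  define A s r where "A = 1 - (cmod w\<^sub>1)\<^sup>2" and "s = (cmod w\<^sub>2)\<^sup>2" and "r = cmod x"
  have s: "0 \<le> s" "s < A" using w[unfolded mem_unit_ball2_iff] by (auto simp: A_def s_def)
  have w1: "cmod w\<^sub>1 < 1" using w by (rule unit_ball2_fst)
  have r0: "r \<ge> 0" by (simp add: r_def)
  have "r \<le> s / (2 * A - s)" using x by (simp add: r_def A_def s_def algebra_simps)
  then have r: "r * (2 * A - s) \<le> s" using s by (simp add: pos_le_divide_eq)
  \<comment> \<open>\<open>sgn 0\<close> is not unimodular; for \<open>x = 0\<close> any unimodular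
    e serves, as \<open>r = 0\<close>.\<close>
  define e where "e = (if x = 0 then 1 else sgn x)"
  have e: "cmod e = 1" "e * r = x" by (auto simp: e_def r_def sgn_eq norm_divide)
  \<comment> \<open>solves \<open>y / (2 A - y) = r\<close>\<close>
  define y where "y = 2 * A * r / (1 + r)"
  \<comment> \<open>The bound \<open>y <= s\<close> is a rearrangement of
    \<open>r * (2 * A - s) <= s\<close>; it is what makes \<open>|\<omega>| <= 1\<close>
    possible.\<close>
  have y: "0 \<le> y" "y \<le> s" using r r0 s by (simp_all add: y_def field_simps)
  have "2 * A - y = 2 * A / (1 + r)" using r0 by (simp add: y_def field_simps)
  then have yr: "y / (2 * A - y) = r" using r0 s by (simp add: y_def)
  \<comment> \<open>solves \<open>t (1 - cnj t w\<^sub>1) = e (1 - t cnj w\<^sub>1)\<close> on the unit circle\<close>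
  define t where "t = disc_moebius w\<^sub>1 (- e)"
  define \<tau> \<kappa> where "\<tau> = cnj t" and "\<kappa> = 1 - \<tau> * w\<^sub>1"
  have nz: "1 - cnj w\<^sub>1 * (- e) \<noteq> 0" using moebius_denom_nonzero[OF w1, of "- e"] e by simp
  have "(cmod t)\<^sup>2 = 1" using one_minus_norm_moebius[OF nz] e by (simp add: t_def)
  then have \<tau>: "cmod \<tau> = 1" by (simp add: \<tau>_def power2_eq_1_iff) (smt (verit) norm_ge_zero)
  \<comment> \<open>Since \<open>t * cnj t = 1\<close>, the equation for t is linear:
    \<open>t - w\<^sub>1 = e - e * t * cnj w\<^sub>1\<close>. Its solution is the Moebius image of
    \<open>- e\<close>.\<close>
  have "t * (1 + cnj w\<^sub>1 * e) = w\<^sub>1 + e" using nz by (simp add: t_def disc_moebius_def)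
  moreover have "t * cnj t = 1" using \<tau> by (simp add: \<tau>_def complex_norm_square[symmetric])
  ultimately have \<tau>\<kappa>: "cnj \<tau> * \<kappa> = e * cnj \<kappa>"
    by (simp add: \<tau>_def \<kappa>_def algebra_simps)
  have \<kappa>0: "\<kappa> \<noteq> 0" using F_fam_moebius(3)[OF w \<tau>, of 0] by (simp add: \<kappa>_def)
  \<comment> \<open>If \<open>w\<^sub>2 = 0\<close>, division by zero makes \<omega> equal to 0;
    this is consistent, as \<open>s = 0\<close> forces \<open>y = 0\<close>.\<close>
  define \<omega> where "\<omega> = csqrt (y * \<kappa> / cnj \<kappa> / w\<^sub>2\<^sup>2)"
  have "cmod \<omega> ^ 2 = y / s"
    unfolding norm_power[symmetric] \<omega>_def using \<kappa>0 y(1) by (simp add: norm_mult norm_divide norm_power s_def)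
  also have "\<dots> \<le> 1" using y s by (cases "s = 0") simp_all
  finally have \<omega>: "cmod \<omega> \<le> 1" by (simp add: power_le_one_iff)
  have u: "\<omega>\<^sup>2 * w\<^sub>2\<^sup>2 = y * \<kappa> / cnj \<kappa>"
    using y by (cases "w\<^sub>2 = 0") (simp_all add: \<omega>_def s_def)
  have "F_fam \<tau> \<omega> (w\<^sub>1, w\<^sub>2) = disc_moebius w\<^sub>1
      (cnj \<tau> * (y * \<kappa> / cnj \<kappa>) * \<kappa> / (2 * \<kappa> * complex_of_real A - y * \<kappa> / cnj \<kappa> * cnj \<kappa>))"
    using F_fam_moebius(4)[OF w \<tau> \<omega>] u by (simp add: \<kappa>_def A_def)
  also have "cnj \<tau> * (y * \<kappa> / cnj \<kappa>) * \<kappa> / (2 * \<kappa> * complex_of_real A - y * \<kappa> / cnj \<kappa> * cnj \<kappa>) =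
      (cnj \<tau> * \<kappa>) / cnj \<kappa> * (\<kappa> * y / (\<kappa> * (2 * complex_of_real A - y)))"
    using \<kappa>0 by (simp add: algebra_simps)
  also have "\<dots> = e * complex_of_real (y / (2 * A - y))"
    unfolding \<tau>\<kappa> using \<kappa>0 by simp
  also have "\<dots> = x" using e yr by simp
  finally show thesis using that \<tau> \<omega> by blast
qed

section \<open>Moebius images of centred discs as Euclidean discs\<close>

text \<open>As the Moebius map is an involution, the image is the pseudohyperbolic disc
  \<open>|a - y| <= \<rho> * |1 - cnj a * y|\<close>. Squaring this and completing the square in y
  yields the Euclidean centre and radius.\<close>

lemma moebius_image_cball:
  assumes a: "cmod a < 1" and \<rho>: "0 \<le> \<rho>" "\<rho> < 1"
  shows "disc_moebius a ` cball 0 \<rho> =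
    cball (complex_of_real ((1 - \<rho>\<^sup>2) / (1 - \<rho>\<^sup>2 * (cmod a)\<^sup>2)) * a)
      (\<rho> * (1 - (cmod a)\<^sup>2) / (1 - \<rho>\<^sup>2 * (cmod a)\<^sup>2))" (is "_ = cball ?c ?r")
proof -
  define k where "k = 1 - \<rho>\<^sup>2 * (cmod a)\<^sup>2"
  have a2: "(cmod a)\<^sup>2 < 1" using a by (simp add: power_less_one_iff)
  have "\<rho>\<^sup>2 * (cmod a)\<^sup>2 \<le> 1 * (cmod a)\<^sup>2"
    using \<rho> by (intro mult_right_mono) (auto simp: power_le_one)
  then have k: "k > 0" using a2 by (simp add: k_def)
  have r0: "?r \<ge> 0" using \<rho> a2 k by (simp add: k_def)
  \<comment> \<open>The completed square: on both sides the coefficient of \<open>|y|^2\<close> is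
    \<open>- k\<close>, and \<open>k > 0\<close> lets the sign be read off.\<close>
  have ident: "\<rho>\<^sup>2 * (cmod (1 - cnj a * y))\<^sup>2 - (cmod (a - y))\<^sup>2 = k * (?r\<^sup>2 - (cmod (y - ?c))\<^sup>2)" for y
  proof -
    have c: "?c = complex_of_real ((1 - \<rho>\<^sup>2) / k) * a" and r: "?r = \<rho> * (1 - (cmod a)\<^sup>2) / k" by (simp_all add: k_def)
    define R where "R = (cmod a)\<^sup>2"
    define P where "P = Re (cnj a * y)"
    have P: "(cmod (1 - cnj a * y))\<^sup>2 = 1 - 2 * P + R * (cmod y)\<^sup>2"
      "(cmod (a - y))\<^sup>2 = R - 2 * P + (cmod y)\<^sup>2"
      "(cmod (y - complex_of_real b * a))\<^sup>2 = (cmod y)\<^sup>2 - 2 * b * P + b\<^sup>2 * R" for b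
      unfolding P_def R_def cmod_power2 by (simp_all add: power2_eq_square algebra_simps)
    have kR: "k = 1 - \<rho>\<^sup>2 * R" by (simp add: k_def R_def)
    have r': "?r = \<rho> * (1 - R) / k" by (simp add: r R_def)
    have "k * (?r\<^sup>2 - (cmod (y - ?c))\<^sup>2) =
        (\<rho>\<^sup>2 * (1 - R)\<^sup>2 - (1 - \<rho>\<^sup>2)\<^sup>2 * R) / k - k * (cmod y)\<^sup>2 + 2 * (1 - \<rho>\<^sup>2) * P"
      unfolding c r' P using k by (simp add: power_divide field_simps power2_eq_square)
    also have "\<rho>\<^sup>2 * (1 - R)\<^sup>2 - (1 - \<rho>\<^sup>2)\<^sup>2 * R = k * (\<rho>\<^sup>2 - R)"
      unfolding kR by (simp add: power2_eq_square algebra_simps)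
    finally have "k * (?r\<^sup>2 - (cmod (y - ?c))\<^sup>2) = \<rho>\<^sup>2 - R - k * (cmod y)\<^sup>2 + 2 * (1 - \<rho>\<^sup>2) * P"
      using k by simp
    also have "\<dots> = \<rho>\<^sup>2 * (cmod (1 - cnj a * y))\<^sup>2 - (cmod (a - y))\<^sup>2"
      unfolding P kR by (simp add: algebra_simps)
    finally show ?thesis ..
  qed
  have iff: "cmod (a - y) \<le> \<rho> * cmod (1 - cnj a * y) \<longleftrightarrow> y \<in> cball ?c ?r" for y
  proof -
    have "cmod (a - y) \<le> \<rho> * cmod (1 - cnj a * y) \<longleftrightarrow> (cmod (a - y))\<^sup>2 \<le> \<rho>\<^sup>2 * (cmod (1 - cnj a * y))\<^sup>2"
      using \<rho> by (simp add: power_mult_distrib[symmetric] abs_le_square_iff[symmetric])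
    also have "\<dots> \<longleftrightarrow> 0 \<le> k * (?r\<^sup>2 - (cmod (y - ?c))\<^sup>2)"
      using ident[of y] by linarith
    also have "\<dots> \<longleftrightarrow> (cmod (y - ?c))\<^sup>2 \<le> ?r\<^sup>2"
      using k by (simp add: zero_le_mult_iff)
    also have "\<dots> \<longleftrightarrow> cmod (y - ?c) \<le> ?r"
      using r0 by (metis norm_ge_zero power_mono power2_le_imp_le)
    finally show ?thesis by (simp add: dist_norm norm_minus_commute)
  qed
  show ?thesis
  proof (intro set_eqI iffI)
    fix y assume "y \<in> disc_moebius a ` cball 0 \<rho>"
    then obtain x where x: "cmod x \<le> \<rho>" "y = disc_moebius a x" by auto
    then have nx: "1 - cnj a * x \<noteq> 0" using moebius_denom_nonzero[OF a] \<rho> by simp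
    have "cmod y < 1" unfolding x(2) using x \<rho> by (intro moebius_in_disc a) simp
    then have ny: "1 - cnj a * y \<noteq> 0" using moebius_denom_nonzero[OF a] by simp
    have "x = disc_moebius a y" using moebius_involution[OF a nx] x by simp
    then have "cmod (disc_moebius a y) \<le> \<rho>" using x by simp
    then have "cmod (a - y) \<le> \<rho> * cmod (1 - cnj a * y)"
      using ny by (simp add: disc_moebius_def norm_divide pos_divide_le_eq)
    then show "y \<in> cball ?c ?r" using iff by blast
  next
    fix y assume "y \<in> cball ?c ?r"
    then have le: "cmod (a - y) \<le> \<rho> * cmod (1 - cnj a * y)" using iff by blast
    \<comment> \<open>Membership of y in the unit disc is not known here. A vanishing denominator
      would force \<open>y = a\<close> through \<open>le\<close>, where the denominator is
      nonzero.\<close>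
    have ny: "1 - cnj a * y \<noteq> 0"
    proof
      assume *: "1 - cnj a * y = 0"
      with le have "y = a" by simp
      with * moebius_denom_nonzero[OF a, of a] a show False by simp
    qed
    then have "cmod (disc_moebius a y) \<le> \<rho>"
      using le by (simp add: disc_moebius_def norm_divide pos_divide_le_eq)
    then show "y \<in> disc_moebius a ` cball 0 \<rho>"
      using moebius_involution[OF a ny] by (metis image_eqI mem_cball_0)
  qed
qed

section \<open>The equality of the three sets and the final statement\<close>

text \<open>The cycle of inclusions from \<open>?I\<close> to \<open>?M\<close> to \<open>?T\<close>
  and back to \<open>?I\<close> proves both equalities at once.\<close>

lemma interp_values_eq:
  assumes w: "(w\<^sub>1, w\<^sub>2) \<in> \<B>\<^sub>2"
  shows "interp_values (w\<^sub>1, w\<^sub>2) =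
      disc_moebius w\<^sub>1 ` cball 0 ((cmod w\<^sub>2)\<^sup>2 / (2 - 2 * (cmod w\<^sub>1)\<^sup>2 - (cmod w\<^sub>2)\<^sup>2))" (is "?I = ?M")
    and "interp_values (w\<^sub>1, w\<^sub>2) =
      {F_fam \<tau> \<omega> (w\<^sub>1, w\<^sub>2) | \<tau> \<omega>. cmod \<tau> = 1 \<and> cmod \<omega> \<le> 1}" (is "_ = ?T")
proof -
  have w1: "cmod w\<^sub>1 < 1"
    using w by (rule unit_ball2_fst)
  have "?I \<subseteq> ?M"
  proof
    fix v assume "v \<in> ?I"
    then obtain F where F: "F holomorphic2_on \<B>\<^sub>2" "F ` \<B>\<^sub>2 \<subseteq> \<D>" "\<And>z\<^sub>1. z\<^sub>1 \<in> \<D> \<Longrightarrow> F (z\<^sub>1, 0) = z\<^sub>1"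
      and v: "v = F (w\<^sub>1, w\<^sub>2)" unfolding interp_values_def by blast
    have "cmod v < 1" using F(2) w by (auto simp: v image_subset_iff)
    then have "v = disc_moebius w\<^sub>1 (disc_moebius w\<^sub>1 v)"
      using moebius_involution[OF w1] moebius_denom_nonzero[OF w1] by simp
    moreover have "disc_moebius w\<^sub>1 v \<in> cball 0 ((cmod w\<^sub>2)\<^sup>2 / (2 - 2 * (cmod w\<^sub>1)\<^sup>2 - (cmod w\<^sub>2)\<^sup>2))"
      using interp_value_bound[OF F w] by (simp add: v)
    ultimately show "v \<in> ?M" by (rule image_eqI)
  qed
  moreover have "?M \<subseteq> ?T"
  proof
    fix v assume "v \<in> ?M"
    then obtain x where x: "cmod x \<le> (cmod w\<^sub>2)\<^sup>2 / (2 - 2 * (cmod w\<^sub>1)\<^sup>2 - (cmod w\<^sub>2)\<^sup>2)"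
      and v: "v = disc_moebius w\<^sub>1 x" by auto
    obtain \<tau> \<omega> where "cmod \<tau> = 1" "cmod \<omega> \<le> 1" "F_fam \<tau> \<omega> (w\<^sub>1, w\<^sub>2) = disc_moebius w\<^sub>1 x"
      using moebius_disc_value_is_F_fam_value[OF w x] .
    then show "v \<in> ?T" unfolding v by (intro CollectI exI conjI) auto
  qed
  moreover have "?T \<subseteq> ?I" using F_fam_in_interp_values[OF w] by blast
  ultimately show "?I = ?M" "?I = ?T" by auto
qed

theorem theorem2:
  fixes w\<^sub>1 w\<^sub>2 :: complex
  assumes "(w\<^sub>1, w\<^sub>2) \<in> \<B>\<^sub>2"
  shows "interp_values (w\<^sub>1, w\<^sub>2) =
           disc_moebius w\<^sub>1 ` interp_values (0, w\<^sub>2 / complex_of_real (sqrt (1 - (cmod w\<^sub>1)\<^sup>2))) \<and>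
         interp_values (w\<^sub>1, w\<^sub>2) =
           disc_moebius w\<^sub>1 ` cball 0 ((cmod w\<^sub>2)\<^sup>2 / (2 - 2 * (cmod w\<^sub>1)\<^sup>2 - (cmod w\<^sub>2)\<^sup>2)) \<and>
         (\<exists>c r. 0 \<le> r \<and> interp_values (w\<^sub>1, w\<^sub>2) = cball c r) \<and>
         (w\<^sub>2 = 0 \<longrightarrow> (\<exists>c. interp_values (w\<^sub>1, w\<^sub>2) = {c})) \<and>
         interp_values (w\<^sub>1, w\<^sub>2) =
           {F_fam \<tau> \<omega> (w\<^sub>1, w\<^sub>2) | \<tau> \<omega>. cmod \<tau> = 1 \<and> cmod \<omega> \<le> 1}"
proof -
  note eq = interp_values_eq[OF assms]
  define A s \<rho> where "A = 1 - (cmod w\<^sub>1)\<^sup>2" and "s = (cmod w\<^sub>2)\<^sup>2" and "\<rho> = s / (2 * A - s)"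
  have s: "0 \<le> s" "s < A" using assms[unfolded mem_unit_ball2_iff] by (auto simp: A_def s_def)
  have w1: "cmod w\<^sub>1 < 1" using assms by (rule unit_ball2_fst)
  have \<rho>: "(cmod w\<^sub>2)\<^sup>2 / (2 - 2 * (cmod w\<^sub>1)\<^sup>2 - (cmod w\<^sub>2)\<^sup>2) = \<rho>"
    by (simp add: \<rho>_def A_def s_def algebra_simps)
  have \<rho>_bounds: "0 \<le> \<rho>" "\<rho> < 1" using s by (simp_all add: \<rho>_def)
  define v where "v = w\<^sub>2 / complex_of_real (sqrt (1 - (cmod w\<^sub>1)\<^sup>2))"
  have v: "(cmod v)\<^sup>2 = s / A"
    using s unfolding v_def A_def[symmetric] by (simp add: norm_divide power_divide s_def[symmetric])
  have "(0, v) \<in> \<B>\<^sub>2" unfolding mem_unit_ball2_iff using v s by simp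
  \<comment> \<open>Over the centre the Moebius map is negation, which preserves centred discs. As
    \<open>|v|^2 = s / A\<close>, the radius at \<open>(0, v)\<close> is
    \<open>(s / A) / (2 - s / A) = s / (2 * A - s)\<close>, the same \<rho> as at w.\<close>
  from interp_values_eq(1)[OF this]
  have "interp_values (0, v) = uminus ` cball 0 ((s / A) / (2 - s / A))"
    by (simp add: v disc_moebius_def)
  also have "(s / A) / (2 - s / A) = \<rho>" using s by (simp add: \<rho>_def field_simps)
  also have "uminus ` cball 0 \<rho> = cball (0::complex) \<rho>"
  proof (intro equalityI subsetI)
    fix x :: complex assume "x \<in> cball 0 \<rho>"
    then show "x \<in> uminus ` cball 0 \<rho>" by (intro image_eqI[of _ _ "- x"]) auto
  qed auto

  finally have first: "interp_values (w\<^sub>1, w\<^sub>2) = disc_moebius w\<^sub>1 ` interp_values (0, v)"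
    using eq(1) by (simp add: \<rho>)
  have "\<exists>c r. 0 \<le> r \<and> interp_values (w\<^sub>1, w\<^sub>2) = cball c r"
    unfolding eq(1) \<rho> moebius_image_cball[OF w1 \<rho>_bounds]
  proof (intro exI conjI)
    have "\<rho>\<^sup>2 * (cmod w\<^sub>1)\<^sup>2 \<le> 1 * 1"
      using \<rho>_bounds w1 by (intro mult_mono) (auto simp: power_le_one)
    then show "0 \<le> \<rho> * (1 - (cmod w\<^sub>1)\<^sup>2) / (1 - \<rho>\<^sup>2 * (cmod w\<^sub>1)\<^sup>2)"
      using \<rho>_bounds s by (auto simp: A_def)
  qed (rule refl)
  moreover have "\<exists>c. interp_values (w\<^sub>1, w\<^sub>2) = {c}" if "w\<^sub>2 = 0"
    using eq(1) that by simp
  ultimately show ?thesis using first eq unfolding v_def by blast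
qed

end
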